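(* Let $A_1\preceq_L A_2\preceq_L\cdots\preceq_L A_{2n}$ be a sequence of $2n$ pairwise commuting Hermitian matrices of the same order. Then for all $\sigma\in S_{2n}$, $$\sum_{i=1}^n A_iA_{2n-i+1}\preceq_L\sum_{i=1}^n A_{\sigma(2i-1)}A_{\sigma(2i)}\preceq_L\sum_{i=1}^n A_{2i-1}A_{2i}.$$ If in addition $A_1\succeq_L 0$, then for all $\sigma\in S_{2n}$, $$\prod_{i=1}^n (A_{2i-1}+A_{2i})\preceq_L\prod_{i=1}^n (A_{\sigma(2i-1)}+A_{\sigma(2i)})\preceq_L\prod_{i=1}^n (A_i+A_{2n-i+1}).$$
   Context: $\preceq_L$ is the Loewner partial order on Hermitian matrices: $A\succeq_L B$ if and only if $A-B$ is positive semidefinite. Products are matrix products. $S_{2n}$ is the symmetric group on $\{1,\dots,2n\}$. *)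

theory Defs
  imports "HOL-Analysis.Analysis"
begin

definition adjoint_matrix :: "complex^'n^'m \<Rightarrow> complex^'m^'n" where
  "adjoint_matrix A = map_matrix cnj (transpose A)"

definition hermitian_matrix :: "complex^'n^'n \<Rightarrow> bool" where
  "hermitian_matrix A \<longleftrightarrow> adjoint_matrix A = A"

text \<open>The complex number \<open>x\<^sup>* A x\<close>. The inner product of the library on \<^typ>\<open>complex^'n\<close> is
  the real one, so it cannot be used here.\<close>

definition quadratic_form :: "complex^'n^'n \<Rightarrow> complex^'n \<Rightarrow> complex" where
  "quadratic_form A x = (\<Sum>i\<in>UNIV. cnj (x $ i) * (A *v x) $ i)"

definition psd_matrix :: "complex^'n^'n \<Rightarrow> bool" where
  "psd_matrix A \<longleftrightarrow> hermitian_matrix A \<and> (\<forall>x. quadratic_form A x \<in> \<real>\<^sub>\<ge>\<^sub>0)"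

text \<open>The Loewner order is a relation on Hermitian matrices, so it is false outside of them.\<close>

definition loewner_le :: "complex^'n^'n \<Rightarrow> complex^'n^'n \<Rightarrow> bool"  (infix \<open>\<preceq>\<^sub>L\<close> 50) where
  "A \<preceq>\<^sub>L B \<longleftrightarrow> hermitian_matrix A \<and> hermitian_matrix B \<and> psd_matrix (B - A)"

text \<open>The matrix product \<open>F 1 ** F 2 ** \<dots> ** F n\<close>. The library operator \<^const>\<open>prod\<close> is not
  applicable, since \<open>*\<close> on \<^typ>\<open>complex^'n^'n\<close> is the entrywise product.\<close>

definition matrix_prod :: "nat \<Rightarrow> (nat \<Rightarrow> complex^'n^'n) \<Rightarrow> complex^'n^'n" where
  "matrix_prod n F = foldr (\<lambda>i M. F i ** M) [1..<Suc n] (mat 1)"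

end

theory Submission
  imports Defs
begin

text \<open>If \<open>Q - P\<close> commutes with all \<open>A i\<close> and its least eigenvalue is negative, then the corresponding
  eigenspace contains a joint eigenvector of the \<open>A i\<close>. So both parts need only be checked on joint
  eigenvectors, where they are inequalities for an increasing sequence of reals. These hold by
  exchange: pairs \<open>{x, u}\<close>, \<open>{y, v}\<close> are replaced by \<open>{x, y}\<close>, \<open>{u, v}\<close>, where \<open>x\<close>, \<open>y\<close> are the two
  largest entries for the consecutive pairing, and the least and the largest one for the opposite
  pairing.\<close>

subsection \<open>Pairings of a finite increasing sequence\<close>

text \<open>A pairing is kept as a multiset of pairs of values instead of a permutation of indices,
  so re-pairing needs no relabelling. All that is retained of \<open>\<sigma>\<close> is which
  values occur.\<close>

definition entries :: "('a \<times> 'a) multiset \<Rightarrow> 'a multiset" where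
  "entries P = image_mset fst P + image_mset snd P"

lemma entries_empty [simp]: "entries {#} = {#}"
  by (simp add: entries_def)

lemma entries_add_mset [simp]: "entries (add_mset (x, y) P) = add_mset x (add_mset y (entries P))"
  by (simp add: entries_def)

lemma entries_consecutive_pairs:
  fixes n :: nat
  shows "entries (image_mset (\<lambda>i. (a (2*i - 1), a (2*i))) (mset_set {1..n})) = image_mset a (mset_set {1..2*n})"
proof (induction n)
  case (Suc n)
  have "{1..2 * Suc n} = insert (2*n + 2) (insert (2*n + 1) {1..2*n})"
    by auto
  with Suc show ?case
    by (simp add: atLeastAtMostSuc_conv add_mset_commute)
qed simp

text \<open>This treats sums of products and products of sums at once. \<open>supermodular\<close>
  is the two-pair case: \<open>x\<close>, \<open>u\<close> are the lower and \<open>v\<close>,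
  \<open>y\<close> the upper values, and matching lower with lower and upper with upper is best.
  \<open>D\<close> restricts the values to those for which combining with \<open>g x y\<close> is
  monotone.\<close>

locale exchange = comm_monoid_mset f z
  for f :: "'b \<Rightarrow> 'b \<Rightarrow> 'b" (infixl \<open>\<^bold>*\<close> 70) and z :: 'b (\<open>\<^bold>1\<close>) +
  fixes g :: "'a::linorder \<Rightarrow> 'a \<Rightarrow> 'b" and D :: "'a set" and le :: "'b \<Rightarrow> 'b \<Rightarrow> bool" (infix \<open>\<sqsubseteq>\<close> 50)
  assumes le_refl: "c \<sqsubseteq> c"
    and le_trans: "c \<sqsubseteq> d \<Longrightarrow> d \<sqsubseteq> e \<Longrightarrow> c \<sqsubseteq> e"
    and le_mono: "x \<in> D \<Longrightarrow> y \<in> D \<Longrightarrow> c \<sqsubseteq> d \<Longrightarrow> g x y \<^bold>* c \<sqsubseteq> g x y \<^bold>* d"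
    and g_commute: "g x y = g y x"
    and supermodular: "x \<in> D \<Longrightarrow> y \<in> D \<Longrightarrow> u \<in> D \<Longrightarrow> v \<in> D \<Longrightarrow> x \<le> v \<Longrightarrow> u \<le> y \<Longrightarrow>
      g x y \<^bold>* g v u \<sqsubseteq> g x u \<^bold>* g v y"
begin

definition pair_total :: "('a \<times> 'a) multiset \<Rightarrow> 'b" where
  "pair_total P = F (image_mset (\<lambda>(x, y). g x y) P)"

lemma total_empty [simp]: "pair_total {#} = \<^bold>1"
  by (simp add: pair_total_def)

lemma total_add_mset [simp]: "pair_total (add_mset (x, y) P) = g x y \<^bold>* pair_total P"
  by (simp add: pair_total_def)

text \<open>Lifts an exchange within two pairs to the whole pairing: the other pairs are put back
  one at a time by \<open>le_mono\<close>.\<close>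

lemma total_mono:
  assumes "set_mset (entries P) \<subseteq> D" and "c \<sqsubseteq> d"
  shows "c \<^bold>* pair_total P \<sqsubseteq> d \<^bold>* pair_total P"
  using assms(1)
proof (induction P)
  case empty
  then show ?case using assms(2) by simp
next
  case (add p P)
  obtain x y where p: "p = (x, y)" by force
  have "g x y \<^bold>* (c \<^bold>* pair_total P) \<sqsubseteq> g x y \<^bold>* (d \<^bold>* pair_total P)"
    using add p by (intro le_mono) auto
  then show ?case
    by (simp add: p left_commute)
qed

lemma entries_split:
  assumes "x \<in># entries P"
  obtains u P' where "entries P = add_mset x (add_mset u (entries P'))" "pair_total P = g x u \<^bold>* pair_total P'"
proof -
  from assms consider (fst) u where "(x, u) \<in># P" | (snd) u where "(u, x) \<in># P"
    by (force simp: entries_def)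
  then show thesis
  proof cases
    case fst
    then obtain P' where "P = add_mset (x, u) P'"
      by (meson multi_member_split)
    then show thesis by (intro that[of u P']) auto
  next
    case snd
    then obtain P' where "P = add_mset (u, x) P'"
      by (meson multi_member_split)
    then show thesis by (intro that[of u P']) (auto simp: g_commute)
  qed
qed

text \<open>If \<open>x\<close> and \<open>y\<close> are paired with \<open>u\<close> and \<open>v\<close>, then \<open>P'\<close> pairs \<open>u\<close> with \<open>v\<close> instead.\<close>

lemma entries_split2:
  assumes "entries P = add_mset x (add_mset y V)"
  obtains (paired) P' where "entries P' = V" "pair_total P = g x y \<^bold>* pair_total P'"
    | (crossed) u v P'' where "V = add_mset u (add_mset v (entries P''))"
        "pair_total P = (g x u \<^bold>* g y v) \<^bold>* pair_total P''"
proof -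
  have "x \<in># entries P" by (simp add: assms)
  then obtain u P1 where 1: "entries P = add_mset x (add_mset u (entries P1))" "pair_total P = g x u \<^bold>* pair_total P1"
    by (rule entries_split)
  then have eq: "add_mset y V = add_mset u (entries P1)"
    using assms by simp
  show thesis
  \<comment> \<open>Values are compared, not occurrences: if the partner of \<open>x\<close> has the
    value \<open>y\<close>, the two count as paired. Otherwise \<open>y\<close> must lie in one of
    the remaining pairs.\<close>
  proof (cases "y = u")
    case True
    then show thesis using 1 eq paired[of P1] by simp
  next
    case False
    then have "y \<in># entries P1"
      using eq by (metis insert_noteq_member)
    then obtain v P2 where 2: "entries P1 = add_mset y (add_mset v (entries P2))" "pair_total P1 = g y v \<^bold>* pair_total P2"
      by (rule entries_split)
    then have "add_mset y V = add_mset y (add_mset u (add_mset v (entries P2)))"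
      using eq by (simp add: add_mset_commute)
    then show thesis
      using 1 2 crossed[of u v P2] by (simp add: assoc)
  qed
qed

text \<open>Induction from the top: once the two largest values are matched, the rest pairs
  \<open>a 1, ..., a (2*n)\<close>. Hence \<open>a\<close> stays fixed and only \<open>P\<close> is
  generalised.\<close>

lemma total_le_consecutive:
  fixes a :: "nat \<Rightarrow> 'a" and n :: nat
  assumes "mono_on {1..2*n} a" and "a ` {1..2*n} \<subseteq> D"
    and "entries P = image_mset a (mset_set {1..2*n})"
  shows "pair_total P \<sqsubseteq> F (image_mset (\<lambda>i. g (a (2*i - 1)) (a (2*i))) (mset_set {1..n}))"
  using assms
proof (induction n arbitrary: P)
  case 0
  then have "P = {#}" by (simp add: entries_def)
  then show ?case by (simp add: le_refl)
next
  case (Suc n)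
  define V where "V = image_mset a (mset_set {1..2*n})"
  define x y where "x = a (2*n + 1)" and "y = a (2*n + 2)"
  have set: "{1..2 * Suc n} = insert (2*n + 2) (insert (2*n + 1) {1..2*n})"
    by auto
  have P: "entries P = add_mset x (add_mset y V)"
    unfolding Suc.prems(3) set by (simp add: V_def x_def y_def add_mset_commute)
  have D: "x \<in> D" "y \<in> D" "set_mset V \<subseteq> D"
    using Suc.prems(2) unfolding set by (auto simp: V_def x_def y_def)
  have max: "w \<le> x" "w \<le> y" if "w \<in># V" for w
    using that Suc.prems(1) by (auto simp: V_def x_def y_def mono_on_def)
  have mono: "mono_on {1..2*n} a" and range: "a ` {1..2*n} \<subseteq> D"
    using Suc.prems(1,2) by (auto intro: mono_on_subset)
  let ?S = "F (image_mset (\<lambda>i. g (a (2*i - 1)) (a (2*i))) (mset_set {1..n}))"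
  have IH: "g x y \<^bold>* pair_total Q \<sqsubseteq> g x y \<^bold>* ?S" if "entries Q = V" for Q
    using Suc.IH[OF mono range, of Q] that D unfolding V_def by (intro le_mono)
  have "pair_total P \<sqsubseteq> g x y \<^bold>* ?S"
    using P
  proof (cases rule: entries_split2)
    case (paired P')
    then show ?thesis using IH by simp
  next
    case (crossed u v P'')
    have uv: "u \<in> D" "v \<in> D" "set_mset (entries P'') \<subseteq> D" "u \<le> y" "v \<le> x"
      using crossed(1) D max by auto
    \<comment> \<open>Lower values \<open>v\<close>, \<open>u\<close>, upper values
      \<open>x\<close>, \<open>y\<close>: both comparisons hold as \<open>x\<close> and
      \<open>y\<close> bound all of \<open>V\<close> from above.\<close>
    have "g x u \<^bold>* g y v \<sqsubseteq> g x y \<^bold>* g u v"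
      using supermodular[of v y u x] uv D by (simp add: g_commute commute)
    then have "pair_total P \<sqsubseteq> (g x y \<^bold>* g u v) \<^bold>* pair_total P''"
      unfolding crossed(2) using uv by (intro total_mono)
    also have "\<dots> = g x y \<^bold>* pair_total (add_mset (u, v) P'')"
      by (simp add: assoc)
    finally have "pair_total P \<sqsubseteq> g x y \<^bold>* pair_total (add_mset (u, v) P'')" .
    then show ?thesis
      by (rule le_trans) (rule IH, simp add: crossed(1))
  qed
  then show ?case
    by (simp add: atLeastAtMostSuc_conv x_def y_def)
qed

text \<open>Here one value is removed at each end. The rest starts at index 2, so the induction must
  also generalise \<open>a\<close> to allow the shifted sequence \<open>a'\<close>.\<close>

lemma opposite_le_total:
  fixes a :: "nat \<Rightarrow> 'a" and n :: nat
  assumes "mono_on {1..2*n} a" and "a ` {1..2*n} \<subseteq> D"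
    and "entries P = image_mset a (mset_set {1..2*n})"
  shows "F (image_mset (\<lambda>i. g (a i) (a (2*n - i + 1))) (mset_set {1..n})) \<sqsubseteq> pair_total P"
  using assms
proof (induction n arbitrary: a P)
  case 0
  then have "P = {#}" by (simp add: entries_def)
  then show ?case by (simp add: le_refl)
next
  case (Suc n)
  define a' where "a' = (\<lambda>i. a (Suc i))"
  define V where "V = image_mset a' (mset_set {1..2*n})"
  define x y where "x = a 1" and "y = a (2*n + 2)"
  have shift: "mset_set {Suc (Suc 0)..Suc m} = image_mset Suc (mset_set {Suc 0..m})" for m
    by (subst image_mset_mset_set) (auto simp: image_Suc_atLeastAtMost)
  have "{1..2 * Suc n} = insert 1 (insert (2*n + 2) {Suc 1..Suc (2*n)})"
    by auto
  then have set: "mset_set {1..2 * Suc n} = add_mset 1 (add_mset (2*n + 2) (image_mset Suc (mset_set {1..2*n})))"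
    by (simp add: shift)
  have P: "entries P = add_mset x (add_mset y V)"
    unfolding Suc.prems(3) set by (simp add: V_def x_def y_def a'_def multiset.map_comp o_def)
  have D: "x \<in> D" "y \<in> D" "set_mset V \<subseteq> D"
    using Suc.prems(2) by (auto simp: V_def x_def y_def a'_def)
  have max: "x \<le> w" "w \<le> y" if "w \<in># V" for w
    using that Suc.prems(1) by (auto simp: V_def x_def y_def a'_def mono_on_def)
  have mono: "mono_on {1..2*n} a'" and range: "a' ` {1..2*n} \<subseteq> D"
    using Suc.prems(1,2) by (auto simp: a'_def mono_on_def)
  let ?S = "F (image_mset (\<lambda>i. g (a' i) (a' (2*n - i + 1))) (mset_set {1..n}))"
  have IH: "g x y \<^bold>* ?S \<sqsubseteq> g x y \<^bold>* pair_total Q" if "entries Q = V" for Q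
    using Suc.IH[OF mono range, of Q] that D unfolding V_def by (intro le_mono)
  have "g x y \<^bold>* ?S \<sqsubseteq> pair_total P"
    using P
  proof (cases rule: entries_split2)
    case (paired P')
    then show ?thesis using IH by simp
  next
    case (crossed u v P'')
    have uv: "u \<in> D" "v \<in> D" "set_mset (entries P'') \<subseteq> D" "u \<le> y" "x \<le> v"
      using crossed(1) D max by auto
    \<comment> \<open>Now the least value \<open>x\<close> and \<open>u\<close> are the lower
      values, \<open>v\<close> and the largest value \<open>y\<close> the upper ones. Matching
      \<open>x\<close> with \<open>y\<close> is the worse choice.\<close>
    have "g x y \<^bold>* g u v \<sqsubseteq> g x u \<^bold>* g y v"
      using supermodular[of x y u v] uv D by (simp add: g_commute)
    then have "(g x y \<^bold>* g u v) \<^bold>* pair_total P'' \<sqsubseteq> pair_total P"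
      unfolding crossed(2) using uv by (intro total_mono)
    then have "g x y \<^bold>* pair_total (add_mset (u, v) P'') \<sqsubseteq> pair_total P"
      by (simp add: assoc)
    moreover have "g x y \<^bold>* ?S \<sqsubseteq> g x y \<^bold>* pair_total (add_mset (u, v) P'')"
      by (rule IH) (simp add: crossed(1))
    ultimately show ?thesis by (rule le_trans[rotated])
  qed
  moreover have "F (image_mset (\<lambda>i. g (a i) (a (2 * Suc n - i + 1))) (mset_set {1..Suc n})) = g x y \<^bold>* ?S"
  proof -
    have "{1..Suc n} = insert 1 {Suc 1..Suc n}" by auto
    then have "mset_set {1..Suc n} = add_mset 1 (image_mset Suc (mset_set {1..n}))"
      by (simp add: shift)
    \<comment> \<open>The second index is \<open>2*n - i + 2\<close> on the left, which is the
      successor of \<open>2*n - i + 1\<close>; the subtraction is not truncated because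
      \<open>i \<le> n\<close>.\<close>
    moreover have "image_mset (\<lambda>i. g (a (Suc i)) (a (2 * Suc n - Suc i + 1))) (mset_set {1..n})
      = image_mset (\<lambda>i. g (a' i) (a' (2*n - i + 1))) (mset_set {1..n})"
      by (intro image_mset_cong) (auto simp: a'_def Suc_diff_le)
    ultimately show ?thesis
      by (simp add: x_def y_def multiset.map_comp o_def)
  qed
  ultimately show ?case by simp
qed

end

section \<open>Inequalities for increasing sequences of reals\<close>

lemma permuted_pairs:
  fixes n :: nat
  assumes "\<sigma> permutes {1..2*n}"
  shows "entries (image_mset (\<lambda>i. (a (\<sigma> (2*i - 1)), a (\<sigma> (2*i)))) (mset_set {1..n})) = image_mset a (mset_set {1..2*n})"
  using entries_consecutive_pairs[of "a \<circ> \<sigma>" n] permutes_image_mset[OF assms]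
  by (simp flip: multiset.map_comp)

lemma sum_pair_products_bounds:
  fixes a :: "nat \<Rightarrow> real"
  assumes "mono_on {1..2*n} a" and "\<sigma> permutes {1..2*n}"
  shows "(\<Sum>i=1..n. a i * a (2*n - i + 1)) \<le> (\<Sum>i=1..n. a (\<sigma> (2*i - 1)) * a (\<sigma> (2*i)))"
    and "(\<Sum>i=1..n. a (\<sigma> (2*i - 1)) * a (\<sigma> (2*i))) \<le> (\<Sum>i=1..n. a (2*i - 1) * a (2*i))"
proof -
  interpret exchange "(+)" 0 "\<lambda>x y :: real. x * y" UNIV "(\<le>)"
    rewrites "comm_monoid_mset.F (+) (0::real) = sum_mset"
  proof -
    \<comment> \<open>The right side minus the left side is
      \<open>(v - x) * (y - u)\<close>.\<close>
    have key: "x * y + v * u \<le> x * u + v * y" if "x \<le> v" "u \<le> y" for x y u v :: real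
      using mult_nonneg_nonneg[of "v - x" "y - u"] that by (simp add: algebra_simps)
    show "exchange (+) 0 (\<lambda>x y :: real. x * y) UNIV (\<le>)"
      by unfold_locales (auto intro: key mult.commute)
  qed (simp add: sum_mset_def)
  note [simp] = pair_total_def sum_unfold_sum_mset multiset.map_comp o_def
  show "(\<Sum>i=1..n. a i * a (2*n - i + 1)) \<le> (\<Sum>i=1..n. a (\<sigma> (2*i - 1)) * a (\<sigma> (2*i)))"
    using opposite_le_total[OF assms(1) _ permuted_pairs[OF assms(2)]] by simp
  show "(\<Sum>i=1..n. a (\<sigma> (2*i - 1)) * a (\<sigma> (2*i))) \<le> (\<Sum>i=1..n. a (2*i - 1) * a (2*i))"
    using total_le_consecutive[OF assms(1) _ permuted_pairs[OF assms(2)]] by simp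
qed

lemma prod_pair_sums_bounds:
  fixes a :: "nat \<Rightarrow> real"
  assumes "mono_on {1..2*n} a" and "\<sigma> permutes {1..2*n}" and "a ` {1..2*n} \<subseteq> {0..}"
  shows "(\<Prod>i=1..n. a (2*i - 1) + a (2*i)) \<le> (\<Prod>i=1..n. a (\<sigma> (2*i - 1)) + a (\<sigma> (2*i)))"
    and "(\<Prod>i=1..n. a (\<sigma> (2*i - 1)) + a (\<sigma> (2*i))) \<le> (\<Prod>i=1..n. a i + a (2*n - i + 1))"
proof -
  \<comment> \<open>The difference is again \<open>(v - x) * (y - u)\<close>, but in favour of the
    crossed pairs, so the order is reversed and the two extremal pairings swap roles. Nonnegative
    entries make multiplication by \<open>x + y\<close> monotone.\<close>
  interpret exchange "(*)" 1 "\<lambda>x y :: real. x + y" "{0..}" "(\<ge>)"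
    rewrites "comm_monoid_mset.F (*) (1::real) = prod_mset"
  proof -
    have key: "(x + u) * (v + y) \<le> (x + y) * (v + u)" if "x \<le> v" "u \<le> y" for x y u v :: real
      using mult_nonneg_nonneg[of "v - x" "y - u"] that by (simp add: algebra_simps)
    show "exchange (*) 1 (\<lambda>x y :: real. x + y) {0..} (\<ge>)"
      by unfold_locales (auto intro: key add.commute mult_left_mono)
  qed (simp add: prod_mset_def)
  note [simp] = pair_total_def prod_unfold_prod_mset multiset.map_comp o_def
  show "(\<Prod>i=1..n. a (2*i - 1) + a (2*i)) \<le> (\<Prod>i=1..n. a (\<sigma> (2*i - 1)) + a (\<sigma> (2*i)))"
    using total_le_consecutive[OF assms(1,3) permuted_pairs[OF assms(2)]] by simp
  show "(\<Prod>i=1..n. a (\<sigma> (2*i - 1)) + a (\<sigma> (2*i))) \<le> (\<Prod>i=1..n. a i + a (2*n - i + 1))"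
    using opposite_le_total[OF assms(1,3) permuted_pairs[OF assms(2)]] by simp
qed

subsection \<open>Joint eigenvectors and the Loewner order\<close>

text \<open>\<open>v\<close> minimises the Rayleigh quotient over the compact unit sphere of
  \<open>S\<close>. The final bound will reduce positivity of a matrix to the sign of
  \<open>\<mu>\<close>.\<close>

lemma selfadjoint_min_eigenvector:
  fixes T :: "'a::euclidean_space \<Rightarrow> 'a"
  assumes "linear T" and sym: "\<And>x y. T x \<bullet> y = x \<bullet> T y"
    and S: "subspace S" "\<And>x. x \<in> S \<Longrightarrow> T x \<in> S" "\<exists>x\<in>S. x \<noteq> 0"
  obtains v \<mu> where "v \<in> S" "v \<noteq> 0" "T v = \<mu> *\<^sub>R v" "\<And>x. x \<in> S \<Longrightarrow> \<mu> * (x \<bullet> x) \<le> x \<bullet> T x"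
proof -
  interpret T: linear T by fact
  have compact: "compact (S \<inter> sphere 0 1)"
    by (simp add: closed_Int_compact closed_subspace S(1))
  obtain x0 where x0: "x0 \<in> S" "x0 \<noteq> 0" using S(3) by blast
  then have "x0 /\<^sub>R norm x0 \<in> S \<inter> sphere 0 1"
    by (simp add: S(1) subspace_scale)
  then have "S \<inter> sphere 0 1 \<noteq> {}" by blast
  moreover have "continuous_on (S \<inter> sphere 0 1) (\<lambda>x. x \<bullet> T x)"
    using assms(1) by (intro continuous_intros linear_continuous_on) (simp add: linear_conv_bounded_linear)
  ultimately obtain v where v: "v \<in> S \<inter> sphere 0 1" and min: "\<And>x. x \<in> S \<inter> sphere 0 1 \<Longrightarrow> v \<bullet> T v \<le> x \<bullet> T x"
    using continuous_attains_inf[OF compact] by blast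
  define \<mu> where "\<mu> = v \<bullet> T v"
  have bound: "\<mu> * (x \<bullet> x) \<le> x \<bullet> T x" if "x \<in> S" for x
  proof (cases "x = 0")
    case False
    have "x /\<^sub>R norm x \<in> S \<inter> sphere 0 1"
      using False that by (simp add: S(1) subspace_scale)
    then have "\<mu> \<le> (x /\<^sub>R norm x) \<bullet> T (x /\<^sub>R norm x)"
      unfolding \<mu>_def by (rule min)
    also have "\<dots> = (x \<bullet> T x) / (x \<bullet> x)"
      by (simp add: T.scale dot_square_norm power2_eq_square field_simps)
    finally show ?thesis using False by (simp add: pos_le_divide_eq)
  qed (simp add: T.zero)
  \<comment> \<open>The component of \<open>T v\<close> orthogonal to \<open>v\<close>; it lies in
    \<open>S\<close> by invariance and is to be shown zero.\<close>
  define w where "w = T v - \<mu> *\<^sub>R v"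
  have wS: "w \<in> S" using v S by (simp add: w_def subspace_diff subspace_scale)
  have vv: "v \<bullet> v = 1" using v by (simp add: dot_square_norm)
  text \<open>The form \<open>x \<bullet> T x - \<mu> (x \<bullet> x)\<close> is nonnegative on \<open>S\<close> and vanishes at \<open>v\<close>,
    so its derivative at \<open>v\<close> in the direction \<open>w\<close> vanishes.\<close>
  have quad: "2 * t * (w \<bullet> w) \<le> t\<^sup>2 * (w \<bullet> T w - \<mu> * (w \<bullet> w))" for t
  proof -
    have Tv: "T v = w + \<mu> *\<^sub>R v" by (simp add: w_def)
    have vTw: "v \<bullet> T w = T v \<bullet> w" by (simp add: sym)
    have vw: "v \<bullet> w = 0"
      by (simp add: w_def inner_diff_right vv \<mu>_def)
    have "\<mu> * ((v - t *\<^sub>R w) \<bullet> (v - t *\<^sub>R w)) \<le> (v - t *\<^sub>R w) \<bullet> T (v - t *\<^sub>R w)"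
      using v wS by (intro bound) (simp add: S(1) subspace_diff subspace_scale)
    also have "T (v - t *\<^sub>R w) = w + \<mu> *\<^sub>R v - t *\<^sub>R T w"
      by (simp add: T.diff T.scale Tv)
    finally show ?thesis
      using vTw unfolding Tv
      by (simp add: inner_diff_left inner_diff_right inner_add_left inner_add_right vw vv
          inner_commute[of w v] power2_eq_square algebra_simps)
  qed
  have "w \<bullet> w = 0"
  proof (rule ccontr)
    assume "w \<bullet> w \<noteq> 0"
    then have pos: "0 < w \<bullet> w" by simp
    \<comment> \<open>A positive bound for the coefficient of \<open>t\<^sup>2\<close>. With
      \<open>t = (w \<bullet> w) / c\<close> the linear term outweighs the quadratic one.\<close>
    define c where "c = \<bar>w \<bullet> T w - \<mu> * (w \<bullet> w)\<bar> + 1"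
    have c: "0 < c" "w \<bullet> T w - \<mu> * (w \<bullet> w) \<le> c" by (auto simp: c_def)
    have "2 * ((w \<bullet> w) / c) * (w \<bullet> w) \<le> ((w \<bullet> w) / c)\<^sup>2 * c"
      using quad[of "(w \<bullet> w) / c"] mult_left_mono[OF c(2), of "((w \<bullet> w) / c)\<^sup>2"] by simp
    then have "(w \<bullet> w) * (w \<bullet> w) \<le> 0"
      using c(1) by (simp add: power2_eq_square field_simps)
    with mult_pos_pos[OF pos pos] show False by linarith
  qed
  then have "T v = \<mu> *\<^sub>R v" by (simp add: w_def)
  then show thesis
    using that[of v \<mu>] v bound vv by force
qed

text \<open>Induction on \<open>I\<close>: an eigenspace of \<open>T j\<close> within
  \<open>S\<close> is invariant under the other operators because they commute with
  \<open>T j\<close>, so it can replace \<open>S\<close>.\<close>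

lemma joint_eigenvector:
  fixes T :: "'i \<Rightarrow> 'a::euclidean_space \<Rightarrow> 'a"
  assumes "finite I" and "\<And>i. i \<in> I \<Longrightarrow> linear (T i)"
    and "\<And>i x y. i \<in> I \<Longrightarrow> T i x \<bullet> y = x \<bullet> T i y"
    and "\<And>i j x. i \<in> I \<Longrightarrow> j \<in> I \<Longrightarrow> T i (T j x) = T j (T i x)"
    and "subspace S" "\<And>i x. i \<in> I \<Longrightarrow> x \<in> S \<Longrightarrow> T i x \<in> S" "\<exists>x\<in>S. x \<noteq> 0"
  shows "\<exists>v\<in>S. v \<noteq> 0 \<and> (\<exists>a. \<forall>i\<in>I. T i v = a i *\<^sub>R v)"
  using assms
proof (induction I arbitrary: S rule: finite_induct)
  case (insert j I)
  interpret T: linear "T j" by (simp add: insert.prems)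
  obtain u \<mu> where u: "u \<in> S" "u \<noteq> 0" "T j u = \<mu> *\<^sub>R u"
    using selfadjoint_min_eigenvector[of "T j" S] insert.prems by (metis insertI1)
  define E where "E = {x \<in> S. T j x = \<mu> *\<^sub>R x}"
  have "subspace E"
    using \<open>subspace S\<close> by (auto simp: E_def subspace_def T.add T.scale scaleR_add_right)
  moreover have "T i x \<in> E" if "i \<in> I" "x \<in> E" for i x
  proof -
    have "T j (T i x) = T i (\<mu> *\<^sub>R x)"
      using that insert.prems(3)[of j i x] by (simp add: E_def)
    also have "\<dots> = \<mu> *\<^sub>R T i x"
      using that insert.prems(1)[of i] by (simp add: linear_cmul)
    finally show ?thesis
      using that insert.prems(5) by (simp add: E_def)
  qed
  moreover have "\<exists>x\<in>E. x \<noteq> 0" using u by (auto simp: E_def)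
  ultimately have "\<exists>v\<in>E. v \<noteq> 0 \<and> (\<exists>a. \<forall>i\<in>I. T i v = a i *\<^sub>R v)"
    by (intro insert.IH insert.prems(1-3)) blast+
  then obtain v a where va: "v \<in> E" "v \<noteq> 0" "\<forall>i\<in>I. T i v = a i *\<^sub>R v"
    by blast
  then have "\<forall>i\<in>insert j I. T i v = (a(j := \<mu>)) i *\<^sub>R v"
    using \<open>j \<notin> I\<close> by (auto simp: E_def)
  with va show ?case unfolding E_def by blast
qed auto

section \<open>Hermitian matrices as self-adjoint operators on a real Euclidean space\<close>

lemma linear_matrix_vector_mult_complex: "linear ((*v) (A :: complex^'n^'m))"
  by (rule linearI)
     (simp_all add: vec_eq_iff matrix_vector_mult_def distrib_left sum.distrib scaleR_sum_right)

lemma inner_complex_vec: "x \<bullet> y = Re (\<Sum>i\<in>UNIV. cnj (x $ i) * y $ i)" for x y :: "complex^'n"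
  by (simp add: inner_vec_def inner_complex_def)

lemma adjoint_matrix_nth [simp]: "adjoint_matrix A $ i $ j = cnj (A $ j $ i)"
  by (simp add: adjoint_matrix_def transpose_def)

lemma adjoint_matrix_mult: "adjoint_matrix (A ** B) = adjoint_matrix B ** adjoint_matrix A"
  by (simp add: vec_eq_iff matrix_matrix_mult_def mult.commute)

lemma adjoint_matrix_add: "adjoint_matrix (A + B) = adjoint_matrix A + adjoint_matrix B"
  by (simp add: vec_eq_iff)

lemma adjoint_matrix_diff: "adjoint_matrix (A - B) = adjoint_matrix A - adjoint_matrix B"
  by (simp add: vec_eq_iff)

lemma matrix_add_rdistrib: "(A + B) ** C = A ** C + B ** C"
  for A B :: "'a::semiring_1^'n^'m"
  by (simp add: vec_eq_iff matrix_matrix_mult_def distrib_right sum.distrib)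

lemma sesquilinear_adjoint:
  "(\<Sum>i\<in>UNIV. cnj (x $ i) * (A *v y) $ i) = (\<Sum>i\<in>UNIV. cnj ((adjoint_matrix A *v x) $ i) * y $ i)"
  by (simp add: matrix_vector_mult_def sum_distrib_left sum_distrib_right)
     (subst sum.swap, simp add: mult_ac)

lemma hermitian_inner:
  assumes "hermitian_matrix A"
  shows "(A *v x) \<bullet> y = x \<bullet> (A *v y)"
  using assms by (simp add: inner_complex_vec sesquilinear_adjoint hermitian_matrix_def)

text \<open>The form equals its own conjugate, hence its real part, which is the real inner product.
  So positivity can be tested with the latter.\<close>

lemma quadratic_form_hermitian:
  assumes "hermitian_matrix A"
  shows "quadratic_form A x = complex_of_real (x \<bullet> (A *v x))"
proof -
  have "cnj (quadratic_form A x) = quadratic_form A x"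
    using sesquilinear_adjoint[of x A x] assms
    by (simp add: quadratic_form_def hermitian_matrix_def mult.commute)
  then have "quadratic_form A x \<in> \<real>"
    by (simp add: Reals_cnj_iff)
  then show ?thesis
    by (simp add: inner_complex_vec flip: quadratic_form_def)
qed

lemma psd_matrix_iff: "psd_matrix A \<longleftrightarrow> hermitian_matrix A \<and> (\<forall>x. 0 \<le> x \<bullet> (A *v x))"
  by (auto simp: psd_matrix_def quadratic_form_hermitian nonneg_Reals_of_real_iff)

lemma loewner_le_eigenvalues:
  assumes "A \<preceq>\<^sub>L B" and "A *v v = a *\<^sub>R v" "B *v v = b *\<^sub>R v" and "v \<noteq> 0"
  shows "a \<le> b"
proof -
  have "0 \<le> v \<bullet> ((B - A) *v v)"
    using assms(1) by (simp add: loewner_le_def psd_matrix_iff)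
  also have "\<dots> = (b - a) * (v \<bullet> v)"
    using assms(2,3) by (simp add: matrix_vector_mult_diff_rdistrib inner_diff_right algebra_simps)
  finally have "0 \<le> (b - a) * (v \<bullet> v)" .
  moreover have "0 < v \<bullet> v" using assms(4) by simp
  ultimately have "0 \<le> b - a" by (metis not_less zero_le_mult_iff)
  then show ?thesis by simp
qed

text \<open>No joint diagonalisation is needed: one joint eigenvector in the eigenspace of the least
  eigenvalue of \<open>Q - P\<close> decides the sign of that eigenvalue.\<close>

lemma loewner_le_if_joint_eigenvalues_le:
  fixes A :: "'i \<Rightarrow> complex^'n^'n"
  assumes I: "finite I" "\<And>i. i \<in> I \<Longrightarrow> hermitian_matrix (A i)"
      "\<And>i j. i \<in> I \<Longrightarrow> j \<in> I \<Longrightarrow> A i ** A j = A j ** A i"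
    and P: "hermitian_matrix P" "\<And>i. i \<in> I \<Longrightarrow> P ** A i = A i ** P"
    and Q: "hermitian_matrix Q" "\<And>i. i \<in> I \<Longrightarrow> Q ** A i = A i ** Q"
    and eigen: "\<And>v a. v \<noteq> 0 \<Longrightarrow> \<forall>i\<in>I. A i *v v = a i *\<^sub>R v \<Longrightarrow>
      \<exists>p q. p \<le> q \<and> P *v v = p *\<^sub>R v \<and> Q *v v = q *\<^sub>R v"
  shows "P \<preceq>\<^sub>L Q"
proof -
  define T where "T = Q - P"
  have T: "hermitian_matrix T"
    using P(1) Q(1) by (simp add: T_def hermitian_matrix_def adjoint_matrix_diff)
  have T_comm: "T *v (A i *v x) = A i *v (T *v x)" if "i \<in> I" for i x
  proof -
    have "P *v (A i *v x) = A i *v (P *v x)" "Q *v (A i *v x) = A i *v (Q *v x)"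
      using P(2) Q(2) that by (simp_all add: matrix_vector_mul_assoc)
    then show ?thesis
      by (simp add: T_def matrix_vector_mult_diff_rdistrib matrix_vector_mult_diff_distrib)
  qed
  note lin = linear_matrix_vector_mult_complex
  have "\<exists>x\<in>UNIV. x \<noteq> (0 :: complex^'n)"
    by (metis UNIV_I axis_eq_0_iff zero_neq_one)
  then obtain u \<mu> where u: "u \<noteq> 0" "T *v u = \<mu> *\<^sub>R u" and min: "\<And>x. \<mu> * (x \<bullet> x) \<le> x \<bullet> (T *v x)"
    using selfadjoint_min_eigenvector[of "(*v) T" UNIV] lin[of T] hermitian_inner[OF T]
    by (metis UNIV_I subspace_UNIV)
  define E where "E = {x. T *v x = \<mu> *\<^sub>R x}"
  have "\<exists>v\<in>E. v \<noteq> 0 \<and> (\<exists>a. \<forall>i\<in>I. A i *v v = a i *\<^sub>R v)"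
  proof (rule joint_eigenvector[OF I(1)])
    show "subspace E"
      using lin[of T] by (auto simp: E_def subspace_def linear_add linear_cmul scaleR_add_right)
    show "A i *v x \<in> E" if "i \<in> I" "x \<in> E" for i x
      using that lin[of "A i"] by (simp add: E_def T_comm linear_cmul)
    show "\<exists>x\<in>E. x \<noteq> 0" using u by (auto simp: E_def)
  qed (use I lin in \<open>auto simp: hermitian_inner matrix_vector_mul_assoc\<close>)
  then obtain v a where v: "v \<in> E" "v \<noteq> 0" "\<forall>i\<in>I. A i *v v = a i *\<^sub>R v" by blast
  then obtain p q where pq: "p \<le> q" "P *v v = p *\<^sub>R v" "Q *v v = q *\<^sub>R v"
    using eigen by blast
  \<comment> \<open>On \<open>v\<close> the matrix \<open>T\<close> acts both as
    \<open>\<mu>\<close> and as \<open>q - p\<close>, so these agree.\<close>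
  then have "\<mu> *\<^sub>R v = (q - p) *\<^sub>R v"
    using v(1) by (simp add: E_def T_def matrix_vector_mult_diff_rdistrib scaleR_diff_left)
  then have "0 \<le> \<mu>" using v(2) pq(1) by simp
  then have "0 \<le> x \<bullet> (T *v x)" for x
    using min[of x] by (meson inner_ge_zero mult_nonneg_nonneg order_trans)
  then show ?thesis
    using P(1) Q(1) T by (simp add: loewner_le_def psd_matrix_iff T_def)
qed

text \<open>Hermitian elements of the bicommutant: a class of pairwise commuting matrices which contains
  the \<open>A i\<close> and is closed under sums and products.\<close>

definition hermitian_bicommutant :: "(complex^'n^'n) set \<Rightarrow> (complex^'n^'n) set" where
  "hermitian_bicommutant F =
    {B. hermitian_matrix B \<and> (\<forall>C. (\<forall>A\<in>F. A ** C = C ** A) \<longrightarrow> B ** C = C ** B)}"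

context
  fixes F :: "(complex^'n^'n) set"
  assumes hermitian: "\<And>A. A \<in> F \<Longrightarrow> hermitian_matrix A"
    and commute: "\<And>A B. A \<in> F \<Longrightarrow> B \<in> F \<Longrightarrow> A ** B = B ** A"
begin

lemma bicommutant_superset: "A \<in> F \<Longrightarrow> A \<in> hermitian_bicommutant F"
  by (auto simp: hermitian_bicommutant_def hermitian)

text \<open>As \<open>F\<close> is commutative, its members belong to its commutant, so
  \<open>C\<close> commutes with them. Thus \<open>C\<close> itself lies in the commutant, and
  \<open>B\<close> commutes with it.\<close>

lemma bicommutant_commute:
  assumes "B \<in> hermitian_bicommutant F" "C \<in> hermitian_bicommutant F"
  shows "B ** C = C ** B"
proof -
  have "A ** C = C ** A" if "A \<in> F" for A
  proof -
    have "\<forall>A'\<in>F. A' ** A = A ** A'"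
      by (intro ballI commute that)
    then have "C ** A = A ** C"
      using assms(2) unfolding hermitian_bicommutant_def by blast
    then show ?thesis ..
  qed
  then show ?thesis
    using assms(1) unfolding hermitian_bicommutant_def by blast
qed

lemma bicommutant_add:
  "B \<in> hermitian_bicommutant F \<Longrightarrow> C \<in> hermitian_bicommutant F \<Longrightarrow> B + C \<in> hermitian_bicommutant F"
  by (simp add: hermitian_bicommutant_def hermitian_matrix_def adjoint_matrix_add
      matrix_add_ldistrib matrix_add_rdistrib)

text \<open>The adjoint of \<open>B ** C\<close> is \<open>C ** B\<close>, so the product is
  Hermitian because the factors commute.\<close>

lemma bicommutant_mult:
  assumes "B \<in> hermitian_bicommutant F" "C \<in> hermitian_bicommutant F"
  shows "B ** C \<in> hermitian_bicommutant F"
proof -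
  have "hermitian_matrix (B ** C)"
    using assms bicommutant_commute[OF assms]
    by (simp add: hermitian_bicommutant_def hermitian_matrix_def adjoint_matrix_mult)
  moreover have "(B ** C) ** X = X ** (B ** C)" if "\<forall>A\<in>F. A ** X = X ** A" for X
  proof -
    have BX: "B ** X = X ** B" and CX: "C ** X = X ** C"
      using assms that unfolding hermitian_bicommutant_def by blast+
    have "(B ** C) ** X = B ** (X ** C)"
      by (simp only: CX flip: matrix_mul_assoc)
    also have "\<dots> = X ** (B ** C)"
      by (simp only: BX matrix_mul_assoc)
    finally show ?thesis .
  qed
  ultimately show ?thesis by (simp add: hermitian_bicommutant_def)
qed

lemma bicommutant_sum:
  "(\<And>i. i \<in> I \<Longrightarrow> B i \<in> hermitian_bicommutant F) \<Longrightarrow> sum B I \<in> hermitian_bicommutant F"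
proof (induction I rule: infinite_finite_induct)
  case (insert i I)
  then show ?case by (simp add: bicommutant_add)
\<comment> \<open>For empty and for infinite \<open>I\<close> the sum is 0.\<close>
qed (simp_all add: hermitian_bicommutant_def hermitian_matrix_def vec_eq_iff matrix_matrix_mult_def)

lemma bicommutant_foldr:
  "(\<And>i. i \<in> set xs \<Longrightarrow> B i \<in> hermitian_bicommutant F) \<Longrightarrow>
    foldr (\<lambda>i M. B i ** M) xs (mat 1) \<in> hermitian_bicommutant F"
proof (induction xs)
  case Nil
  have "adjoint_matrix (mat 1 :: complex^'n^'n) = mat 1"
    by (simp add: vec_eq_iff mat_def)
  then show ?case by (simp add: hermitian_bicommutant_def hermitian_matrix_def)
qed (simp add: bicommutant_mult)

end

section \<open>Eigenvalues of sums and products\<close>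

lemma mult_eigenvector:
  fixes A B :: "complex^'n^'n"
  assumes "A *v v = a *\<^sub>R v" "B *v v = b *\<^sub>R v"
  shows "(A ** B) *v v = (a * b) *\<^sub>R v"
  using assms linear_cmul[OF linear_matrix_vector_mult_complex, of A b v]
  by (simp add: mult.commute flip: matrix_vector_mul_assoc)

lemma sum_eigenvector:
  fixes B :: "'i \<Rightarrow> complex^'n^'n"
  shows "(\<And>i. i \<in> I \<Longrightarrow> B i *v v = b i *\<^sub>R v) \<Longrightarrow> sum B I *v v = sum b I *\<^sub>R v"
  by (induction I rule: infinite_finite_induct)
     (simp_all add: matrix_vector_mult_add_rdistrib scaleR_add_left)

lemma matrix_prod_eigenvector:
  fixes B :: "nat \<Rightarrow> complex^'n^'n"
  assumes "\<And>i. i \<in> {1..n} \<Longrightarrow> B i *v v = b i *\<^sub>R v"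
  shows "matrix_prod n B *v v = (\<Prod>i=1..n. b i) *\<^sub>R v"
proof -
  have "foldr (\<lambda>i M. B i ** M) xs (mat 1) *v v = prod_list (map b xs) *\<^sub>R v"
    if "set xs \<subseteq> {1..n}" for xs
    using that by (induction xs) (simp_all add: mult_eigenvector assms)
  from this[of "[1..<Suc n]"] show ?thesis
    by (simp del: upt_Suc add: matrix_prod_def atLeastLessThanSuc_atLeastAtMost flip: prod.distinct_set_conv_list)
qed

theorem theorem29:
  fixes A :: "nat \<Rightarrow> complex^'m^'m" and n :: nat
  assumes hermitian: "\<forall>i\<in>{1..2*n}. hermitian_matrix (A i)"
    and commuting: "\<forall>i\<in>{1..2*n}. \<forall>j\<in>{1..2*n}. A i ** A j = A j ** A i"
    and chain: "\<forall>i\<in>{1..<2*n}. A i \<preceq>\<^sub>L A (i + 1)"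
  shows "(\<forall>\<sigma>. \<sigma> permutes {1..2*n} \<longrightarrow>
            (\<Sum>i=1..n. A i ** A (2*n - i + 1)) \<preceq>\<^sub>L (\<Sum>i=1..n. A (\<sigma> (2*i - 1)) ** A (\<sigma> (2*i))) \<and>
            (\<Sum>i=1..n. A (\<sigma> (2*i - 1)) ** A (\<sigma> (2*i))) \<preceq>\<^sub>L (\<Sum>i=1..n. A (2*i - 1) ** A (2*i))) \<and>
         (0 \<preceq>\<^sub>L A 1 \<longrightarrow> (\<forall>\<sigma>. \<sigma> permutes {1..2*n} \<longrightarrow>
            matrix_prod n (\<lambda>i. A (2*i - 1) + A (2*i))
              \<preceq>\<^sub>L matrix_prod n (\<lambda>i. A (\<sigma> (2*i - 1)) + A (\<sigma> (2*i))) \<and>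
            matrix_prod n (\<lambda>i. A (\<sigma> (2*i - 1)) + A (\<sigma> (2*i)))
              \<preceq>\<^sub>L matrix_prod n (\<lambda>i. A i + A (2*n - i + 1))))"
proof -
  define H where "H = hermitian_bicommutant (A ` {1..2*n})"
  have family: "\<And>B. B \<in> A ` {1..2*n} \<Longrightarrow> hermitian_matrix B"
    "\<And>B C. B \<in> A ` {1..2*n} \<Longrightarrow> C \<in> A ` {1..2*n} \<Longrightarrow> B ** C = C ** B"
    using hermitian commuting by blast+
  have A_H: "A i \<in> H" if "i \<in> {1..2*n}" for i
    unfolding H_def using that by (intro bicommutant_superset[OF family]) auto
  \<comment> \<open>Index maps \<open>p\<close>, \<open>q\<close> describe an arbitrary pairing, so
    that one fact covers the opposite, the permuted and the consecutive one.\<close>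
  have sum_H: "(\<Sum>i=1..n. A (p i) ** A (q i)) \<in> H" if "p ` {1..n} \<subseteq> {1..2*n}" "q ` {1..n} \<subseteq> {1..2*n}" for p q
    using A_H that unfolding H_def
    by (intro bicommutant_sum[OF family] bicommutant_mult[OF family]) (auto simp: image_subset_iff)
  have prod_H: "matrix_prod n (\<lambda>i. A (p i) + A (q i)) \<in> H" if "p ` {1..n} \<subseteq> {1..2*n}" "q ` {1..n} \<subseteq> {1..2*n}" for p q
    using A_H that unfolding H_def matrix_prod_def
    by (intro bicommutant_foldr[OF family] bicommutant_add[OF family]) (auto simp: image_subset_iff simp del: upt_Suc)
  have le: "P \<preceq>\<^sub>L Q" if "P \<in> H" "Q \<in> H"
    and "\<And>v a. v \<noteq> 0 \<Longrightarrow> \<forall>i\<in>{1..2*n}. A i *v v = a i *\<^sub>R v \<Longrightarrow>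
      \<exists>p q. p \<le> q \<and> P *v v = p *\<^sub>R v \<and> Q *v v = q *\<^sub>R v" for P Q
  proof (rule loewner_le_if_joint_eigenvalues_le[of "{1..2*n}" A])
    show "hermitian_matrix P" "hermitian_matrix Q"
      using that(1,2) by (simp_all add: H_def hermitian_bicommutant_def)
    show "P ** A i = A i ** P" "Q ** A i = A i ** Q" if "i \<in> {1..2*n}" for i
      using bicommutant_commute[OF family] A_H[OF that] \<open>P \<in> H\<close> \<open>Q \<in> H\<close> unfolding H_def by blast+
    show "A i ** A j = A j ** A i" if "i \<in> {1..2*n}" "j \<in> {1..2*n}" for i j
      using commuting that by blast
  qed (use hermitian that(3) in auto)
  \<comment> \<open>Testing the chain on a common eigenvector turns it into a chain of
    eigenvalues.\<close>
  have mono: "mono_on {1..2*n} a" if "v \<noteq> 0" and a: "\<forall>i\<in>{1..2*n}. A i *v v = a i *\<^sub>R v" for v a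
  proof (rule mono_onI)
    fix i j assume ij: "i \<in> {1..2*n}" "j \<in> {1..2*n}" "i \<le> j"
    from ij(3,2) show "a i \<le> a j"
    proof (induction j rule: dec_induct)
      case (step k)
      have "A k \<preceq>\<^sub>L A (Suc k)" "A k *v v = a k *\<^sub>R v" "A (Suc k) *v v = a (Suc k) *\<^sub>R v"
        using chain a step ij(1) by auto
      then have "a k \<le> a (Suc k)"
        using \<open>v \<noteq> 0\<close> by (rule loewner_le_eigenvalues)
      with step ij(1) show ?case by simp
    qed simp
  qed
  have nonneg: "a ` {1..2*n} \<subseteq> {0..}"
    if "v \<noteq> 0" and a: "\<forall>i\<in>{1..2*n}. A i *v v = a i *\<^sub>R v" and "0 \<preceq>\<^sub>L A 1" for v a
  proof
    fix c assume "c \<in> a ` {1..2*n}"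
    then obtain i where i: "i \<in> {1..2*n}" "c = a i" by blast
    then have "1 \<in> {1..2*n}" by simp
    \<comment> \<open>Every vector is an eigenvector of the zero matrix with eigenvalue 0.\<close>
    then have "0 \<le> a 1"
      using loewner_le_eigenvalues[OF \<open>0 \<preceq>\<^sub>L A 1\<close>, of v 0 "a 1"] a \<open>v \<noteq> 0\<close> by simp
    also have "\<dots> \<le> a i"
      using mono_onD[OF mono[OF \<open>v \<noteq> 0\<close> a] \<open>1 \<in> {1..2*n}\<close> i(1)] i(1) by simp
    finally show "c \<in> {0..}" using i(2) by simp
  qed
  have sum_eigen: "(\<Sum>i=1..n. A (p i) ** A (q i)) *v v = (\<Sum>i=1..n. a (p i) * a (q i)) *\<^sub>R v"
    if "\<forall>i\<in>{1..2*n}. A i *v v = a i *\<^sub>R v" "p ` {1..n} \<subseteq> {1..2*n}" "q ` {1..n} \<subseteq> {1..2*n}" for v a p q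
    using that by (intro sum_eigenvector mult_eigenvector) (auto simp: image_subset_iff)
  have prod_eigen: "matrix_prod n (\<lambda>i. A (p i) + A (q i)) *v v = (\<Prod>i=1..n. a (p i) + a (q i)) *\<^sub>R v"
    if "\<forall>i\<in>{1..2*n}. A i *v v = a i *\<^sub>R v" "p ` {1..n} \<subseteq> {1..2*n}" "q ` {1..n} \<subseteq> {1..2*n}" for v a p q
    using that by (intro matrix_prod_eigenvector) (auto simp: image_subset_iff matrix_vector_mult_add_rdistrib scaleR_add_left)
  \<comment> \<open>The matrix inequality follows from the scalar one for all increasing real
    sequences, applied to the eigenvalues on each joint eigenvector.\<close>
  have sum_le: "(\<Sum>i=1..n. A (p i) ** A (q i)) \<preceq>\<^sub>L (\<Sum>i=1..n. A (p' i) ** A (q' i))"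
    if "p ` {1..n} \<subseteq> {1..2*n}" "q ` {1..n} \<subseteq> {1..2*n}" "p' ` {1..n} \<subseteq> {1..2*n}" "q' ` {1..n} \<subseteq> {1..2*n}"
      and "\<And>a :: nat \<Rightarrow> real. mono_on {1..2*n} a \<Longrightarrow>
        (\<Sum>i=1..n. a (p i) * a (q i)) \<le> (\<Sum>i=1..n. a (p' i) * a (q' i))" for p q p' q'
  proof (rule le)
    fix v :: "complex^'m" and a :: "nat \<Rightarrow> real"
    assume v: "v \<noteq> 0" and a: "\<forall>i\<in>{1..2*n}. A i *v v = a i *\<^sub>R v"
    then show "\<exists>r s. r \<le> s \<and> (\<Sum>i=1..n. A (p i) ** A (q i)) *v v = r *\<^sub>R v \<and>
        (\<Sum>i=1..n. A (p' i) ** A (q' i)) *v v = s *\<^sub>R v"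
      using sum_eigen[OF a that(1,2)] sum_eigen[OF a that(3,4)] that(5)[OF mono[OF v a]] by blast
  qed (rule sum_H; fact)+
  have prod_le: "matrix_prod n (\<lambda>i. A (p i) + A (q i)) \<preceq>\<^sub>L matrix_prod n (\<lambda>i. A (p' i) + A (q' i))"
    if "0 \<preceq>\<^sub>L A 1"
      and "p ` {1..n} \<subseteq> {1..2*n}" "q ` {1..n} \<subseteq> {1..2*n}" "p' ` {1..n} \<subseteq> {1..2*n}" "q' ` {1..n} \<subseteq> {1..2*n}"
      and "\<And>a :: nat \<Rightarrow> real. mono_on {1..2*n} a \<Longrightarrow> a ` {1..2*n} \<subseteq> {0..} \<Longrightarrow>
        (\<Prod>i=1..n. a (p i) + a (q i)) \<le> (\<Prod>i=1..n. a (p' i) + a (q' i))" for p q p' q'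
  proof (rule le)
    fix v :: "complex^'m" and a :: "nat \<Rightarrow> real"
    assume v: "v \<noteq> 0" and a: "\<forall>i\<in>{1..2*n}. A i *v v = a i *\<^sub>R v"
    then show "\<exists>r s. r \<le> s \<and> matrix_prod n (\<lambda>i. A (p i) + A (q i)) *v v = r *\<^sub>R v \<and>
        matrix_prod n (\<lambda>i. A (p' i) + A (q' i)) *v v = s *\<^sub>R v"
      using prod_eigen[OF a that(2,3)] prod_eigen[OF a that(4,5)]
        that(6)[OF mono[OF v a] nonneg[OF v a that(1)]] by blast
  qed (rule prod_H; fact)+
  have perm: "(\<lambda>i. \<sigma> (2*i - 1)) ` {1..n} \<subseteq> {1..2*n}" "(\<lambda>i. \<sigma> (2*i)) ` {1..n} \<subseteq> {1..2*n}"
    if "\<sigma> permutes {1..2*n}" for \<sigma>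
    using permutes_in_image[OF that] by fastforce+
  have opp: "(\<lambda>i. i) ` {1..n} \<subseteq> {1..2*n}" "(\<lambda>i. 2*n - i + 1) ` {1..n} \<subseteq> {1..2*n}"
    and con: "(\<lambda>i. 2*i - 1) ` {1..n} \<subseteq> {1..2*n}" "(\<lambda>i. 2*i) ` {1..n} \<subseteq> {1..2*n}"
    by auto
  show ?thesis
  proof (intro conjI allI impI)
    fix \<sigma> assume \<sigma>: "\<sigma> permutes {1..2*n}"
    note perm = perm[OF \<sigma>]
    show "(\<Sum>i=1..n. A i ** A (2*n - i + 1)) \<preceq>\<^sub>L (\<Sum>i=1..n. A (\<sigma> (2*i - 1)) ** A (\<sigma> (2*i)))"
      by (rule sum_le[OF opp perm]) (rule sum_pair_products_bounds[OF _ \<sigma>])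
    show "(\<Sum>i=1..n. A (\<sigma> (2*i - 1)) ** A (\<sigma> (2*i))) \<preceq>\<^sub>L (\<Sum>i=1..n. A (2*i - 1) ** A (2*i))"
      by (rule sum_le[OF perm con]) (rule sum_pair_products_bounds[OF _ \<sigma>])
    assume A1: "0 \<preceq>\<^sub>L A 1"
    show "matrix_prod n (\<lambda>i. A (2*i - 1) + A (2*i)) \<preceq>\<^sub>L matrix_prod n (\<lambda>i. A (\<sigma> (2*i - 1)) + A (\<sigma> (2*i)))"
      by (rule prod_le[OF A1 con perm]) (rule prod_pair_sums_bounds[OF _ \<sigma>])
    show "matrix_prod n (\<lambda>i. A (\<sigma> (2*i - 1)) + A (\<sigma> (2*i))) \<preceq>\<^sub>L matrix_prod n (\<lambda>i. A i + A (2*n - i + 1))"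
      by (rule prod_le[OF A1 perm opp]) (rule prod_pair_sums_bounds[OF _ \<sigma>])
  qed
qed

end
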